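(* Let $\pi$ be a probability density on $\mathbb{R}^p$ that is continuous at $\theta_0$ with $\pi(\theta_0)>0$. For each $n$ let $f_n:\mathbb{R}^p\to\mathbb{R}$ be measurable with $z_n:=\int e^{f_n(\theta)}\pi(\theta)\,d\theta<\infty$, let $\pi_n(\theta)=e^{f_n(\theta)}\pi(\theta)/z_n$, let $\theta_n\to\theta_0$, and let $q_n(x)=n^{-p/2}\pi_n(\theta_n+x/\sqrt n)$ be the density of $\sqrt n(\theta-\theta_n)$ when $\theta\sim\pi_n$. Assume: (C1) there are symmetric matrices $H_n\to H_0$ with $H_0$ positive definite and functions $r_n$ such that $f_n(\theta)=f_n(\theta_n)-\frac n2(\theta-\theta_n)^\top H_n(\theta-\theta_n)+r_n(\theta)$ for all $\theta$; for every fixed $x\in\mathbb{R}^p$, $r_n(\theta_n+x/\sqrt n)-r_n(\theta_n)\to0$; and there exist $\varepsilon_0>0$, $c_0\ge0$, vectors $c_n\to0$ and reals $d_n$ with $\limsup_n d_n<\infty$ such that for all $n$ and all $x$ with $\|x\|<\varepsilon_0\sqrt n$, $r_n(\theta_n+x/\sqrt n)-r_n(\theta_n)\le c_0\|x\|^3/\sqrt n+x^\top c_n+d_n$; (C2) for every $\varepsilon\in(0,\varepsilon_0)$, $\liminf_{n\to\infty}\inf_{\|\theta-\theta_n\|\ge\varepsilon}\frac{f_n(\theta_n)-f_n(\theta)}{n}>0$. Then $\int_{\mathbb{R}^p}|q_n(x)-\phi(x)|\,dx\to0$, where $\phi$ is the density of $\mathcal{N}_p(0,H_0^{-1})$. 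*)

theory Defs
  imports "HOL-Analysis.Analysis"
begin

definition pos_def_mat :: "real^'p^'p \<Rightarrow> bool" where
  "pos_def_mat A \<longleftrightarrow> (\<forall>x. x \<noteq> 0 \<longrightarrow> x \<bullet> (A *v x) > 0)"

definition gauss_density :: "real^'p^'p \<Rightarrow> real^'p \<Rightarrow> real" where
  "gauss_density S x =
     (2 * pi) powr (- real CARD('p) / 2) * (det S) powr (-1/2)
     * exp (- (x \<bullet> (matrix_inv S *v x)) / 2)"

end

(* Put g_n(x) = exp (f_n (theta_n + x / sqrt n) - f_n (theta_n)) * pi (theta_n + x / sqrt n) and
   g_0(x) = exp (- x^T H_0 x / 2) * pi (theta_0); then q_n and phi are g_n and g_0 divided by their
   integrals, and g_n -> g_0 pointwise.  On the ball of radius eps * sqrt n, with eps small, the cubic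
   term of (C1) is at most c_0 * eps * |x|^2 and so is absorbed by the quadratic form: g_n is dominated
   by a fixed Gaussian.  Outside that ball (C2) gives a total mass of at most exp (- delta n) * n^(p/2).
   Hence the integrals converge, and Scheffe's lemma yields the convergence in L1. *)
theory Submission
  imports Defs "HOL-Probability.Distributions" "HOL-Real_Asymp.Real_Asymp"
begin

section \<open>Linear changes of variables for the Lebesgue measure\<close>

lemma nn_integral_lborel_affine:
  fixes t :: "'a::euclidean_space" and F :: "'a \<Rightarrow> ennreal"
  assumes c: "c \<noteq> 0" and [measurable]: "F \<in> borel_measurable borel"
  shows "(\<integral>\<^sup>+x. F x \<partial>lborel) = ennreal (\<bar>c\<bar> ^ DIM('a)) * (\<integral>\<^sup>+x. F (t + c *\<^sub>R x) \<partial>lborel)"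
  by (subst lborel_affine[OF c, of t])
    (simp add: nn_integral_density nn_integral_distr nn_integral_cmult)

text \<open>By Tonelli the coordinate along \<open>b\<close> can be integrated innermost. On each
  line parallel to \<open>b\<close> the coefficient \<open>a\<close> is constant by
  \<open>inv\<close>, so there the shear is a translation, which preserves one-dimensional Lebesgue
  measure.\<close>

lemma nn_integral_lborel_shear:
  fixes F :: "'a::euclidean_space \<Rightarrow> ennreal"
  assumes b: "b \<in> Basis" and F [measurable]: "F \<in> borel_measurable borel"
    and a [measurable]: "a \<in> borel_measurable borel"
    and inv: "\<And>x t. a (x + t *\<^sub>R b) = a x"
  shows "(\<integral>\<^sup>+x. F (x + a x *\<^sub>R b) \<partial>lborel) = (\<integral>\<^sup>+x. F x \<partial>lborel)"
proof -
  interpret product_sigma_finite "\<lambda>_::'a. lborel :: real measure" by standard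
  have ins: "insert b (Basis - {b}) = Basis" using b by auto
  define y :: "('a \<Rightarrow> real) \<Rightarrow> 'a" where "y g = (\<Sum>i\<in>Basis-{b}. g i *\<^sub>R i)" for g
  have split: "(\<Sum>i\<in>Basis. (g(b := t)) i *\<^sub>R i) = y g + t *\<^sub>R b" for g t
    using b by (simp add: y_def sum.remove[of _ b] add.commute)
  have *: "(\<integral>\<^sup>+x. K x \<partial>lborel) =
      (\<integral>\<^sup>+g. (\<integral>\<^sup>+t. K (y g + t *\<^sub>R b) \<partial>lborel) \<partial>Pi\<^sub>M (Basis - {b}) (\<lambda>_. lborel))"
    if [measurable]: "K \<in> borel_measurable borel" for K
  proof -
    have "(\<integral>\<^sup>+x. K x \<partial>lborel) =
       (\<integral>\<^sup>+g. K (\<Sum>i\<in>Basis. g i *\<^sub>R i) \<partial>Pi\<^sub>M (insert b (Basis - {b})) (\<lambda>_. lborel))"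
      unfolding ins by (subst lborel_eq) (simp add: nn_integral_distr)
    also have "\<dots> = (\<integral>\<^sup>+g. (\<integral>\<^sup>+t. K (\<Sum>i\<in>Basis. (g(b := t)) i *\<^sub>R i) \<partial>lborel)
        \<partial>Pi\<^sub>M (Basis - {b}) (\<lambda>_. lborel))"
      by (rule product_nn_integral_insert) (auto simp: ins)
    finally show ?thesis unfolding split .
  qed
  have "(\<integral>\<^sup>+t. F (y g + t *\<^sub>R b + a (y g + t *\<^sub>R b) *\<^sub>R b) \<partial>lborel)
      = (\<integral>\<^sup>+t. F (y g + t *\<^sub>R b) \<partial>lborel)" for g
    using nn_integral_lborel_affine[of 1 "\<lambda>t. F (y g + t *\<^sub>R b)" "a (y g)"]
    by (simp add: inv algebra_simps)
  then show ?thesis by (subst (1 2) *) simp_all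
qed

text \<open>Lebesgue measure is determined by its values on boxes. Swapping two coordinates turns a
  box into a box with the same side lengths in another order, and the product of the side lengths
  does not see the order.\<close>

lemma nn_integral_lborel_transpose_coords:
  fixes F :: "real^'n \<Rightarrow> ennreal"
  assumes [measurable]: "F \<in> borel_measurable borel"
  shows "(\<integral>\<^sup>+x. F (\<chi> i. x $ Transposition.transpose m k i) \<partial>lborel) = (\<integral>\<^sup>+x. F x \<partial>lborel)"
proof -
  let ?\<tau> = "Transposition.transpose m k"
  define T :: "real^'n \<Rightarrow> real^'n" where "T x = (\<chi> i. x $ ?\<tau> i)" for x
  have "continuous_on UNIV T"
    unfolding T_def by (intro continuous_intros)
  then have [measurable]: "T \<in> borel_measurable borel"
    by (rule borel_measurable_continuous_onI)
  have "lborel = distr lborel borel T"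
  proof (rule lborel_eqI)
    fix l u :: "real^'n" assume le: "\<And>b. b \<in> Basis \<Longrightarrow> l \<bullet> b \<le> u \<bullet> b"
    have le': "l $ i \<le> u $ i" for i
      using le[of "axis i 1"] by (simp add: axis_in_Basis_iff inner_axis)
    have "T -` box l u = box (T l) (T u)"
      by (auto simp: T_def mem_box_cart) (metis transpose_involutory)+
    moreover have "\<And>b. b \<in> Basis \<Longrightarrow> T l \<bullet> b \<le> T u \<bullet> b"
      by (auto simp: T_def Basis_vec_def inner_axis le')
    ultimately have "emeasure (distr lborel borel T) (box l u) = (\<Prod>b\<in>Basis. (T u - T l) \<bullet> b)"
      by (simp add: emeasure_distr)
    also have "(\<Prod>b\<in>Basis. (T u - T l) \<bullet> b) = (\<Prod>i\<in>UNIV. (u - l) $ ?\<tau> i)"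
      by (simp add: Basis_vec_def T_def inner_axis UNION_singleton_eq_range prod.reindex inj_on_def axis_eq_axis)
    also have "\<dots> = (\<Prod>i\<in>UNIV. (u - l) $ i)"
      by (rule prod.reindex_bij_betw) (simp add: bij_transpose)
    also have "\<dots> = (\<Prod>b\<in>Basis. (u - l) \<bullet> b)"
      by (simp add: Basis_vec_def inner_axis UNION_singleton_eq_range prod.reindex inj_on_def axis_eq_axis)
    finally show "emeasure (distr lborel borel T) (box l u) = (\<Prod>b\<in>Basis. (u - l) \<bullet> b)" .
  qed simp
  then have "(\<integral>\<^sup>+x. F x \<partial>lborel) = (\<integral>\<^sup>+x. F x \<partial>distr lborel borel T)" by simp
  then show ?thesis by (simp add: nn_integral_distr T_def)
qed

lemma borel_measurable_matrix_vector_mult [measurable]: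
  "(\<lambda>x. (A :: real^'n^'m) *v x) \<in> borel_measurable borel"
  by (intro borel_measurable_continuous_onI linear_continuous_on)
     (simp add: linear_linear)

text \<open>The change of variables theorems of the library require a well-ordered index type.\<close>

lemma nn_integral_lborel_matrix:
  fixes A :: "real^'n^'n" and F :: "real^'n \<Rightarrow> ennreal"
  assumes "det A \<noteq> 0" and "F \<in> borel_measurable borel"
  shows "(\<integral>\<^sup>+x. F x \<partial>lborel) = ennreal \<bar>det A\<bar> * (\<integral>\<^sup>+x. F (A *v x) \<partial>lborel)"
  using assms
\<comment> \<open>The formula is multiplicative in \<open>A\<close>, so elementary matrices suffice.
  \<open>F\<close> stays arbitrary because the product case applies the hypothesis for
  \<open>B\<close> to the function \<open>F (A *v x)\<close>.\<close>
proof (induction A arbitrary: F rule: induct_matrix_elementary_alt[case_names mult zero_row diagonal swap1 idplus])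
  case (mult A B)
  have det: "det A \<noteq> 0" "det B \<noteq> 0" using mult(3) by (auto simp: det_mul)
  note [measurable] = mult(4)
  note mult(1)[OF det(1) mult(4)]
  also have "(\<integral>\<^sup>+x. F (A *v x) \<partial>lborel) = ennreal \<bar>det B\<bar> * (\<integral>\<^sup>+x. F (A *v (B *v x)) \<partial>lborel)"
    by (rule mult(2)[OF det(2)]) measurable
  finally show ?case
    unfolding det_mul abs_mult matrix_vector_mul_assoc
    by (simp only: ennreal_mult abs_ge_zero mult.assoc)
next
  case (zero_row A i)
  then show ?case using det_zero_row[of i A] by (simp add: row_def vec_eq_iff)
next
  case (diagonal A)
  note [measurable] = \<open>F \<in> borel_measurable borel\<close>
  have det: "det A = (\<Prod>i\<in>UNIV. A $ i $ i)"
    using diagonal(1) by (simp add: det_diagonal)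
  \<comment> \<open>On a standard basis vector this reads off the diagonal entry of
    \<open>A\<close>. It presents the matrix as a scaling of each basis direction, the form used by
    \<open>lborel_affine_euclidean\<close>.\<close>
  define c :: "real^'n \<Rightarrow> real" where "c b = b \<bullet> (A *v b)" for b
  have Ax: "(A *v x) $ i = A $ i $ i * x $ i" for x i
    unfolding matrix_vector_mult_def using diagonal(1)
    by (simp add: sum.remove[of _ i])
  have c_axis: "c (axis i 1) = A $ i $ i" for i
    by (simp add: c_def inner_axis' Ax)
  have c_ne: "c j \<noteq> 0" if "j \<in> Basis" for j
    using that diagonal(2) det by (auto simp: Basis_vec_def c_axis)
  have T: "(\<Sum>j\<in>Basis. (c j * (x \<bullet> j)) *\<^sub>R j) = A *v x" for x
  proof -
    have "(\<Sum>j\<in>Basis. (c j * (x \<bullet> j)) *\<^sub>R j) = (\<Sum>i\<in>UNIV. (A $ i $ i * x $ i) *\<^sub>R axis i 1)"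
      by (simp add: Basis_vec_def UNION_singleton_eq_range sum.reindex inj_on_def axis_eq_axis
          c_axis inner_axis)
    also have "\<dots> = A *v x"
      using basis_expansion[of "A *v x"] by (simp add: Ax scalar_mult_eq_scaleR)
    finally show ?thesis .
  qed
  have P: "(\<Prod>j\<in>Basis. \<bar>c j\<bar>) = \<bar>det A\<bar>"
    by (simp add: det abs_prod Basis_vec_def UNION_singleton_eq_range prod.reindex inj_on_def
        axis_eq_axis c_axis)
  have "lborel = density (distr lborel borel (\<lambda>x. A *v x)) (\<lambda>_. \<bar>det A\<bar>)"
    using lborel_affine_euclidean[of c 0] c_ne by (simp add: T P)
  then have "(\<integral>\<^sup>+x. F x \<partial>lborel) = (\<integral>\<^sup>+x. F x \<partial>density (distr lborel borel (\<lambda>x. A *v x)) (\<lambda>_. \<bar>det A\<bar>))"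
    by simp
  then show ?case
    by (simp add: nn_integral_density nn_integral_distr nn_integral_cmult)
next
  case (swap1 m k)
  let ?P = "(\<chi> i j. mat 1 $ i $ Transposition.transpose m k j) :: real^'n^'n"
  have "\<bar>det ?P\<bar> = 1"
    by (subst det_permute_columns) (auto simp: permutes_swap_id sign_swap_id)
  moreover have "?P *v x = (\<chi> i. x $ Transposition.transpose m k i)" for x
  proof -
    have "(\<Sum>j\<in>UNIV. mat 1 $ i $ Transposition.transpose m k j * x $ j)
        = (\<Sum>j\<in>UNIV. if j = Transposition.transpose m k i then x $ j else 0)" for i
      by (rule sum.cong) (auto simp: mat_def)
    then show ?thesis by (simp add: vec_eq_iff matrix_vector_mult_def)
  qed
  ultimately show ?case
    using nn_integral_lborel_transpose_coords[OF swap1(3), of m k] by simp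
next
  case (idplus m k)
  let ?E = "(\<chi> i j. of_bool (i = m \<and> j = k \<or> i = j)) :: real^'n^'n"
  have "?E = (\<chi> i. if i = m then row m (mat 1) + 1 *s row k (mat 1) else row i (mat 1))"
    using idplus(1) by (auto simp: vec_eq_iff row_def mat_def)
  then have "det ?E = 1"
    using det_row_operation[OF idplus(1), of "mat 1 :: real^'n^'n" 1] by simp
  moreover have "?E *v x = x + (x $ k) *\<^sub>R axis m 1" for x
  proof -
    have "(\<Sum>j\<in>UNIV. of_bool (i = m \<and> j = k \<or> i = j) * x $ j) = x $ i + x $ k * axis m 1 $ i" for i
    proof (cases "i = m")
      case True
      have "(\<Sum>j\<in>UNIV. of_bool (i = m \<and> j = k \<or> i = j) * x $ j)
          = (\<Sum>j\<in>UNIV. (if j = k then x $ j else 0) + (if j = m then x $ j else 0))"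
        by (rule sum.cong) (use True idplus(1) in auto)
      then show ?thesis using True by (simp add: sum.distrib)
    next
      case False
      have "(\<Sum>j\<in>UNIV. of_bool (i = m \<and> j = k \<or> i = j) * x $ j)
          = (\<Sum>j\<in>UNIV. (if j = i then x $ j else 0))"
        by (rule sum.cong) (use False in auto)
      then show ?thesis using False by (simp add: axis_def)
    qed
    then show ?thesis by (simp add: vec_eq_iff matrix_vector_mult_def)
  qed
  \<comment> \<open>The matrix adds coordinate \<open>k\<close> to coordinate \<open>m\<close>. As
    \<open>k\<close> and \<open>m\<close> differ, moving along \<open>axis m 1\<close> leaves
    \<open>x $ k\<close> unchanged, which is the invariance required of a shear coefficient.\<close>
  moreover have "(\<integral>\<^sup>+x. F (x + (x $ k) *\<^sub>R axis m 1) \<partial>lborel) = (\<integral>\<^sup>+x. F x \<partial>lborel)"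
    by (rule nn_integral_lborel_shear)
      (use idplus in \<open>auto simp: axis_in_Basis_iff\<close>, simp add: axis_def)
  ultimately show ?case by simp
qed

section \<open>Gaussian integrals\<close>

text \<open>Gram-Schmidt for the inner product given by \<open>A\<close>. Fewer vectors than the
  dimension have been chosen, so their images under \<open>A\<close> do not span. A nonzero
  \<open>v\<close> Euclidean-orthogonal to these images is form-orthogonal to the chosen vectors,
  and positive definiteness permits its normalisation.\<close>

lemma exists_form_orthonormal_family:
  fixes A :: "real^'n^'n"
  assumes sym: "transpose A = A" and pd: "pos_def_mat A" and "finite S"
  shows "\<exists>b :: 'n \<Rightarrow> real^'n. \<forall>i\<in>S. \<forall>j\<in>S. b i \<bullet> (A *v b j) = of_bool (i = j)"
  using \<open>finite S\<close>
proof (induction S)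
  case empty
  then show ?case by simp
next
  case (insert k S)
  then obtain b :: "'n \<Rightarrow> real^'n" where b: "\<And>i j. i \<in> S \<Longrightarrow> j \<in> S \<Longrightarrow> b i \<bullet> (A *v b j) = of_bool (i = j)"
    by blast
  have self: "x \<bullet> (A *v y) = y \<bullet> (A *v x)" for x y
    by (metis dot_lmul_matrix inner_commute sym transpose_matrix_vector)
  have "card S < CARD('n)"
    using insert by (metis UNIV_I finite_class.finite_UNIV psubsetI psubset_card_mono subset_UNIV)
  then have "dim ((\<lambda>i. A *v b i) ` S) < DIM(real^'n)"
    using dim_le_card'[of "(\<lambda>i. A *v b i) ` S"] card_image_le[OF \<open>finite S\<close>, of "\<lambda>i. A *v b i"] insert
    by (simp add: dim_le_card)
  then obtain v where v: "v \<noteq> 0" "\<And>y. y \<in> span ((\<lambda>i. A *v b i) ` S) \<Longrightarrow> orthogonal v y"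
    by (rule orthogonal_to_subspace_exists) blast
  define w where "w = (1 / sqrt (v \<bullet> (A *v v))) *\<^sub>R v"
  have "v \<bullet> (A *v v) > 0" using pd v by (auto simp: pos_def_mat_def)
  then have ww: "w \<bullet> (A *v w) = 1"
    by (simp add: w_def matrix_vector_mult_scaleR)
  have wb: "w \<bullet> (A *v b i) = 0" if "i \<in> S" for i
    using v(2)[of "A *v b i"] that by (simp add: w_def orthogonal_def span_base)
  have "\<forall>i\<in>insert k S. \<forall>j\<in>insert k S. (b(k := w)) i \<bullet> (A *v (b(k := w)) j) = of_bool (i = j)"
    using b ww wb self insert(2) by auto
  then show ?case by blast
qed

text \<open>The columns of \<open>M\<close> are a basis orthonormal for the form. The substitution x
  = M y then turns the quadratic form of \<open>A\<close> into the squared Euclidean norm of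
  y.\<close>

lemma pos_def_mat_congruent_one:
  fixes A :: "real^'n^'n"
  assumes "transpose A = A" and "pos_def_mat A"
  obtains M :: "real^'n^'n" where "transpose M ** A ** M = mat 1"
proof -
  obtain b :: "'n \<Rightarrow> real^'n" where b: "\<And>i j. b i \<bullet> (A *v b j) = of_bool (i = j)"
    using exists_form_orthonormal_family[OF assms, of UNIV] by auto
  define M where "M = (\<chi> i j. b j $ i)"
  have "(transpose M ** (A ** M)) $ i $ j = b i \<bullet> (A *v b j)" for i j
    by (simp add: M_def matrix_matrix_mult_def transpose_def matrix_vector_mult_def inner_vec_def)
  then have "transpose M ** (A ** M) = mat 1"
    by (simp add: vec_eq_iff mat_def b)
  then show ?thesis using that by (simp add: matrix_mul_assoc)
qed

text \<open>The integrand is a product over the coordinates, and each factor is sqrt (2 pi) times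
  the standard normal density, which has mass one.\<close>

lemma nn_integral_exp_neg_norm_square:
  "(\<integral>\<^sup>+x. ennreal (exp (- (norm (x :: 'a::euclidean_space))\<^sup>2 / 2)) \<partial>lborel)
    = ennreal ((2 * pi) powr (real DIM('a) / 2))"
proof -
  have one: "(\<integral>\<^sup>+t. ennreal (exp (- (t::real)\<^sup>2 / 2)) \<partial>lborel) = ennreal (sqrt (2 * pi))"
  proof -
    have "(\<integral>\<^sup>+t. ennreal (exp (- (t::real)\<^sup>2 / 2)) \<partial>lborel)
       = (\<integral>\<^sup>+t. ennreal (sqrt (2 * pi)) * ennreal (std_normal_density t) \<partial>lborel)"
      by (rule nn_integral_cong) (simp add: std_normal_density_def flip: ennreal_mult)
    also have "\<dots> = ennreal (sqrt (2 * pi))"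
      by (subst nn_integral_cmult) (simp_all add: nn_integral_eq_integral)
    finally show ?thesis .
  qed
  have "ennreal (exp (- (norm x)\<^sup>2 / 2)) = (\<Prod>b\<in>Basis. ennreal (exp (- (x \<bullet> b)\<^sup>2 / 2)))" for x :: 'a
  proof -
    have "(norm x)\<^sup>2 = (\<Sum>b\<in>Basis. (x \<bullet> b)\<^sup>2)"
      unfolding power2_norm_eq_inner by (subst euclidean_inner) (simp add: power2_eq_square)
    then show ?thesis
      by (simp add: prod_ennreal exp_sum[symmetric] sum_negf[symmetric] sum_divide_distrib)
  qed
  then have "(\<integral>\<^sup>+x. ennreal (exp (- (norm (x::'a))\<^sup>2 / 2)) \<partial>lborel) = (\<Prod>b\<in>(Basis::'a set). ennreal (sqrt (2 * pi)))"
    using nn_integral_lborel_prod[where 'a='a and f="\<lambda>_ t. ennreal (exp (- t\<^sup>2 / 2))"] one by simp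
  also have "\<dots> = ennreal (sqrt (2 * pi) ^ DIM('a))" by (simp add: ennreal_power)
  also have "sqrt (2 * pi) ^ DIM('a) = (2 * pi) powr (real DIM('a) / 2)"
    by (simp add: powr_half_sqrt[symmetric] powr_powr flip: powr_realpow)
  finally show ?thesis .
qed

text \<open>Taking determinants in M^T A M = 1 gives (det M)^2 * det A = 1. This yields the sign of
  \<open>det A\<close> and shows that the Jacobian of x = M y is \<open>det A powr (-1/2)\<close>;
  the remaining integral is the standard one.\<close>

lemma
  fixes A :: "real^'n^'n"
  assumes "transpose A = A" and "pos_def_mat A"
  shows pos_def_mat_det_pos: "det A > 0"
    and nn_integral_exp_neg_quadratic_form:
      "(\<integral>\<^sup>+x. ennreal (exp (- (x \<bullet> (A *v x)) / 2)) \<partial>lborel)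
        = ennreal ((2 * pi) powr (real CARD('n) / 2) * det A powr (-1/2))"
proof -
  obtain M :: "real^'n^'n" where M: "transpose M ** A ** M = mat 1"
    using pos_def_mat_congruent_one[OF assms] .
  have "det (transpose M ** A ** M) = 1" by (simp add: M)
  then have dd: "(det M)\<^sup>2 * det A = 1"
    by (simp add: det_mul power2_eq_square mult_ac)
  then have dM: "det M \<noteq> 0" by auto
  show pos: "det A > 0"
    using dd dM by (metis zero_less_mult_pos zero_less_one zero_less_power2)
  have "\<bar>det M\<bar> = det A powr (-1/2)"
  proof -
    have "(det M)\<^sup>2 = 1 / det A" using dd pos by (simp add: field_simps)
    then have "\<bar>det M\<bar> = sqrt (1 / det A)" by (metis real_sqrt_abs)
    then show ?thesis using pos
      by (simp add: powr_half_sqrt[symmetric] powr_minus_divide powr_divide)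
  qed
  moreover have "(M *v x) \<bullet> (A *v (M *v x)) = (norm x)\<^sup>2" for x
  proof -
    have "(M *v x) \<bullet> (A *v (M *v x)) = x \<bullet> ((transpose M ** A ** M) *v x)"
      by (metis dot_lmul_matrix inner_commute matrix_vector_mul_assoc transpose_matrix_vector transpose_transpose)
    then show ?thesis by (simp add: M power2_norm_eq_inner)
  qed
  ultimately show "(\<integral>\<^sup>+x. ennreal (exp (- (x \<bullet> (A *v x)) / 2)) \<partial>lborel)
        = ennreal ((2 * pi) powr (real CARD('n) / 2) * det A powr (-1/2))"
    by (subst nn_integral_lborel_matrix[OF dM])
      (simp_all add: nn_integral_exp_neg_norm_square[simplified] mult.commute flip: ennreal_mult)
qed

lemma matrix_inv_matrix_inv:
  fixes A :: "real^'n^'n"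
  assumes "det A \<noteq> 0"
  shows "matrix_inv (matrix_inv A) = A" and "det (matrix_inv A) = 1 / det A"
proof -
  have inv: "invertible A" using assms by (simp add: invertible_det_nz)
  then have AB: "A ** matrix_inv A = mat 1" "matrix_inv A ** A = mat 1"
    unfolding invertible_def matrix_inv_def by (rule someI2_ex, simp)+
  then have inv': "invertible (matrix_inv A)" by (auto simp: invertible_def)
  then have BC: "matrix_inv A ** matrix_inv (matrix_inv A) = mat 1"
    unfolding invertible_def matrix_inv_def[of "matrix_inv A"] by (rule someI2_ex) simp
  show "matrix_inv (matrix_inv A) = A"
    by (metis AB(1) BC matrix_mul_assoc matrix_mul_lid matrix_mul_rid)
  have "det A * det (matrix_inv A) = 1" by (metis AB(1) det_I det_mul)
  then show "det (matrix_inv A) = 1 / det A" using assms by (simp add: field_simps)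
qed

text \<open>Brings the limiting density to the form of an exponential divided by its own integral:
  with covariance \<open>matrix_inv A\<close> the exponent contains \<open>A\<close> again, and the
  constant is the value found in \<open>nn_integral_exp_neg_quadratic_form\<close>.\<close>

lemma gauss_density_matrix_inv:
  fixes A :: "real^'n^'n"
  assumes "transpose A = A" and "pos_def_mat A"
  shows "gauss_density (matrix_inv A) x = exp (- (x \<bullet> (A *v x)) / 2)
    / ((2 * pi) powr (real CARD('n) / 2) * det A powr (-1/2))"
  using pos_def_mat_det_pos[OF assms]
  by (simp add: gauss_density_def matrix_inv_matrix_inv powr_minus powr_divide divide_simps)

text \<open>The norm on matrices is the Euclidean norm of the vector of row norms, so Cauchy-Schwarz
  in each row suffices. It lets the convergence of \<open>H\<close> in this norm control the
  quadratic forms.\<close>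

lemma norm_matrix_vector_mult_le:
  fixes A :: "real^'n^'m"
  shows "norm (A *v x) \<le> norm A * norm x"
proof -
  have "norm (A *v x) = L2_set (\<lambda>i. \<bar>A $ i \<bullet> x\<bar>) UNIV"
    by (simp add: norm_vec_def[of "A *v x"] matrix_vector_mul_component)
  also have "\<dots> \<le> L2_set (\<lambda>i. norm x * norm (A $ i)) UNIV"
    by (rule L2_set_mono) (metis Cauchy_Schwarz_ineq2 mult.commute, simp)
  also have "\<dots> = norm x * norm A"
    by (simp add: L2_set_right_distrib norm_vec_def[of A])
  finally show ?thesis by (simp add: mult.commute)
qed

text \<open>\<open>m\<close> is the minimum of the form on the compact unit sphere, positive by
  definiteness; homogeneity of degree two extends the bound to all vectors.\<close>

lemma pos_def_mat_coercive:
  fixes A :: "real^'n^'n"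
  assumes "transpose A = A" and "pos_def_mat A"
  obtains m where "m > 0" and "\<And>x. x \<bullet> (A *v x) \<ge> m * (norm x)\<^sup>2"
proof -
  let ?q = "\<lambda>x. x \<bullet> (A *v x)"
  have "continuous_on (sphere 0 1) ?q"
    by (intro continuous_intros linear_continuous_on) (simp add: linear_linear)
  moreover have "sphere (0::real^'n) 1 \<noteq> {}"
    using vector_choose_size[of 1] by auto
  ultimately obtain u where u: "u \<in> sphere 0 1" and min: "\<And>y. y \<in> sphere 0 1 \<Longrightarrow> ?q u \<le> ?q y"
    using continuous_attains_inf[of "sphere 0 1" ?q] by auto
  have "u \<noteq> 0" using u by auto
  then have "?q u > 0" using assms(2) by (simp add: pos_def_mat_def)
  moreover have "?q x \<ge> ?q u * (norm x)\<^sup>2" for x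
  proof (cases "x = 0")
    case False
    have "?q u \<le> ?q ((1 / norm x) *\<^sub>R x)" by (rule min) (use False in simp)
    also have "\<dots> = ?q x / (norm x)\<^sup>2"
      by (simp add: matrix_vector_mult_scaleR power2_eq_square)
    finally show ?thesis using False by (simp add: field_simps)
  qed simp
  ultimately show ?thesis using that by blast
qed

section \<open>Convergence of the normalised densities\<close>

text \<open>Convergence of the integrals makes the normalised functions converge pointwise; the
  limit has mass one and no approximant has more, so Scheffe's lemma applies.\<close>

lemma normalised_L1_convergence:
  fixes g :: "nat \<Rightarrow> 'a \<Rightarrow> real"
  assumes int: "\<And>n. integrable M (g n)" and int0: "integrable M g0"
    and nonneg: "\<And>n x. g n x \<ge> 0" and nonneg0: "\<And>x. g0 x \<ge> 0"
    and lim: "\<And>x. (\<lambda>n. g n x) \<longlonglongrightarrow> g0 x"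
    and lim_int: "(\<lambda>n. \<integral>x. g n x \<partial>M) \<longlonglongrightarrow> (\<integral>x. g0 x \<partial>M)"
    and pos: "(\<integral>x. g0 x \<partial>M) > 0"
  shows "(\<lambda>n. \<integral>\<^sup>+x. ennreal \<bar>g n x / (\<integral>x. g n x \<partial>M) - g0 x / (\<integral>x. g0 x \<partial>M)\<bar> \<partial>M) \<longlonglongrightarrow> 0"
proof -
  have mass: "(\<integral>\<^sup>+x. ennreal (norm (h x / (\<integral>x. h x \<partial>M))) \<partial>M)
      = ennreal ((\<integral>x. h x \<partial>M) / (\<integral>x. h x \<partial>M))"
    if "integrable M h" "\<And>x. h x \<ge> 0" for h :: "'a \<Rightarrow> real"
    using that by (subst nn_integral_eq_integral) (auto simp: integral_nonneg_AE)
  \<comment> \<open>Each mass is an integral divided by itself: one, or zero when the integral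
    vanishes, since division by zero gives zero. In both cases it is at most the mass one of the
    limit.\<close>
  have "limsup (\<lambda>n. \<integral>\<^sup>+x. ennreal (norm (g n x / (\<integral>x. g n x \<partial>M))) \<partial>M)
      \<le> (\<integral>\<^sup>+x. ennreal (norm (g0 x / (\<integral>x. g0 x \<partial>M))) \<partial>M)"
    unfolding mass[OF int nonneg] mass[OF int0 nonneg0]
    using pos by (intro Limsup_bounded always_eventually allI ennreal_leI) simp
  moreover have "(\<lambda>n. g n x / (\<integral>x. g n x \<partial>M)) \<longlonglongrightarrow> g0 x / (\<integral>x. g0 x \<partial>M)" for x
    using pos by (intro tendsto_divide lim lim_int) simp
  ultimately show ?thesis
    using Scheffe_lemma1[of M "\<lambda>n x. g n x / (\<integral>x. g n x \<partial>M)" "\<lambda>x. g0 x / (\<integral>x. g0 x \<partial>M)"]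
    by (simp add: int int0)
qed

text \<open>Dominated convergence is applied to \<open>g n\<close> cut off to \<open>S n\<close>,
  which keeps the pointwise limit because every point eventually lies in \<open>S n\<close>. The
  mass removed by the cutoff vanishes by \<open>tail\<close>.\<close>

lemma tendsto_integral_truncate:
  fixes g :: "nat \<Rightarrow> 'a \<Rightarrow> real"
  assumes [measurable]: "\<And>n. g n \<in> borel_measurable M" "\<And>n. S n \<in> sets M"
    and nonneg: "\<And>n x. g n x \<ge> 0" and int_w: "integrable M w"
    and lim: "\<And>x. (\<lambda>n. g n x) \<longlonglongrightarrow> g0 x"
    and exhaust: "\<And>x. x \<in> space M \<Longrightarrow> eventually (\<lambda>n. x \<in> S n) sequentially"
    and dom: "\<And>n x. x \<in> S n \<Longrightarrow> g n x \<le> w x"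
    and int: "\<And>n. integrable M (g n)"
    and tail: "(\<lambda>n. \<integral>x. g n x * indicator (- S n) x \<partial>M) \<longlonglongrightarrow> 0"
  shows "integrable M g0" and "(\<lambda>n. \<integral>x. g n x \<partial>M) \<longlonglongrightarrow> (\<integral>x. g0 x \<partial>M)"
proof -
  have [measurable]: "g0 \<in> borel_measurable M"
    by (rule borel_measurable_LIMSEQ_real[OF lim]) measurable
  have lim': "AE x in M. (\<lambda>n. g n x * indicator (S n) x) \<longlonglongrightarrow> g0 x"
  proof (rule AE_I2)
    fix x assume "x \<in> space M"
    from exhaust[OF this] have "eventually (\<lambda>n. g n x * indicator (S n) x = g n x) sequentially"
      by eventually_elim simp
    then show "(\<lambda>n. g n x * indicator (S n) x) \<longlonglongrightarrow> g0 x"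
      using lim[of x] by (subst tendsto_cong)
  qed
  have dom': "AE x in M. norm (g n x * indicator (S n) x) \<le> norm (w x)" for n
  proof (rule AE_I2)
    fix x
    show "norm (g n x * indicator (S n) x) \<le> norm (w x)"
      using dom[of x n] nonneg[of n x] by (cases "x \<in> S n") auto
  qed
  note DC = lim' dom' integrable_norm[OF int_w]
  show "integrable M g0"
    by (rule integrable_dominated_convergence[OF _ _ DC(3,1,2)]) measurable
  have "(\<lambda>n. \<integral>x. g n x * indicator (S n) x \<partial>M) \<longlonglongrightarrow> (\<integral>x. g0 x \<partial>M)"
    by (rule integral_dominated_convergence[OF _ _ DC(3,1,2)]) measurable
  from tendsto_add[OF this tail]
  have "(\<lambda>n. (\<integral>x. g n x * indicator (S n) x \<partial>M) + (\<integral>x. g n x * indicator (- S n) x \<partial>M))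
      \<longlonglongrightarrow> (\<integral>x. g0 x \<partial>M)" by simp
  moreover have "(\<integral>x. g n x * indicator (S n) x \<partial>M) + (\<integral>x. g n x * indicator (- S n) x \<partial>M)
      = (\<integral>x. g n x \<partial>M)" for n
  proof -
    have *: "g n x * indicator (- S n) x = g n x - g n x * indicator (S n) x" for x
      by (simp split: split_indicator)
    have "integrable M (\<lambda>x. g n x * indicator (S n) x)"
      by (rule integrable_real_mult_indicator[OF _ int]) simp
    then show ?thesis
      unfolding * by (simp add: int)
  qed
  ultimately show "(\<lambda>n. \<integral>x. g n x \<partial>M) \<longlonglongrightarrow> (\<integral>x. g0 x \<partial>M)" by simp
qed

text \<open>Scaling by \<open>sqrt (2 * a)\<close> reduces the claim to the standard Gaussian
  integral.\<close>

lemma integrable_exp_neg_norm_square: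
  assumes "a > 0"
  shows "integrable lborel (\<lambda>x :: 'a::euclidean_space. exp (- (a * (norm x)\<^sup>2)))"
proof (rule integrableI_nonneg)
  have "sqrt (2 * a) \<noteq> 0" using assms by simp
  from nn_integral_lborel_affine[OF this, of "\<lambda>x :: 'a. ennreal (exp (- (norm x)\<^sup>2 / 2))" 0]
  have "ennreal (sqrt (2 * a) ^ DIM('a)) * (\<integral>\<^sup>+x. ennreal (exp (- (a * (norm (x :: 'a))\<^sup>2))) \<partial>lborel)
      = ennreal ((2 * pi) powr (real DIM('a) / 2))"
    using assms by (simp add: nn_integral_exp_neg_norm_square[simplified] power_mult_distrib mult.assoc)
  then have "ennreal (sqrt (2 * a) ^ DIM('a)) * (\<integral>\<^sup>+x. ennreal (exp (- (a * (norm (x :: 'a))\<^sup>2))) \<partial>lborel) < top"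
    by simp
  moreover have "\<not> sqrt (2 * a) ^ DIM('a) \<le> 0"
    using assms by (simp add: not_le)
  ultimately show "(\<integral>\<^sup>+x. ennreal (exp (- (a * (norm (x :: 'a))\<^sup>2))) \<partial>lborel) < \<infinity>"
    by (auto simp: ennreal_mult_less_top ennreal_eq_0_iff)
qed simp_all

text \<open>Passes to the local coordinate x with \<theta> = t + c x. It serves both for the
  normalising constant of the posterior and for the total mass of the prior.\<close>

lemma integral_lborel_affine_nonneg:
  fixes F :: "'a::euclidean_space \<Rightarrow> real"
  assumes [measurable]: "F \<in> borel_measurable borel" and nonneg: "\<And>x. F x \<ge> 0"
    and fin: "(\<integral>\<^sup>+x. ennreal (F x) \<partial>lborel) < \<infinity>" and c: "c > 0"
  shows "integrable lborel (\<lambda>x. F (t + c *\<^sub>R x))"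
    and "enn2real (\<integral>\<^sup>+x. ennreal (F x) \<partial>lborel) = c ^ DIM('a) * (\<integral>x. F (t + c *\<^sub>R x) \<partial>lborel)"
proof -
  have eq: "(\<integral>\<^sup>+x. ennreal (F x) \<partial>lborel) = ennreal (c ^ DIM('a)) * (\<integral>\<^sup>+x. ennreal (F (t + c *\<^sub>R x)) \<partial>lborel)"
    using nn_integral_lborel_affine[of c "\<lambda>x. ennreal (F x)" t] c by simp
  have "\<not> c ^ DIM('a) \<le> 0" using c by (simp add: not_le)
  then have "(\<integral>\<^sup>+x. ennreal (F (t + c *\<^sub>R x)) \<partial>lborel) < \<infinity>"
    using fin unfolding eq by (auto simp: ennreal_mult_less_top ennreal_eq_0_iff)
  then show int: "integrable lborel (\<lambda>x. F (t + c *\<^sub>R x))"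
    by (intro integrableI_nonneg) (simp_all add: nonneg)
  show "enn2real (\<integral>\<^sup>+x. ennreal (F x) \<partial>lborel) = c ^ DIM('a) * (\<integral>x. F (t + c *\<^sub>R x) \<partial>lborel)"
    unfolding eq using c by (simp add: nn_integral_eq_integral[OF int] nonneg enn2real_mult)
qed

lemma exp_neg_mult_sqrt_power_tendsto_0:
  assumes "\<delta> > (0::real)"
  shows "(\<lambda>n. exp (- \<delta> * real n) * sqrt (real n) ^ p) \<longlonglongrightarrow> 0"
  using assms by real_asymp

theorem mainTheorem3:
  fixes \<pi> :: "real^'p \<Rightarrow> real"
    and \<theta>0 :: "real^'p"
    and f :: "nat \<Rightarrow> real^'p \<Rightarrow> real"
    and \<theta>n :: "nat \<Rightarrow> real^'p"
    and H :: "nat \<Rightarrow> real^'p^'p" and H0 :: "real^'p^'p"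
    and r :: "nat \<Rightarrow> real^'p \<Rightarrow> real"
    and \<epsilon>0 c0 :: real and c :: "nat \<Rightarrow> real^'p" and d :: "nat \<Rightarrow> real"
  assumes \<pi>_meas: "\<pi> \<in> borel_measurable lborel"
    and \<pi>_nonneg: "\<And>\<theta>. \<pi> \<theta> \<ge> 0"
    and \<pi>_int: "(\<integral>\<^sup>+ \<theta>. ennreal (\<pi> \<theta>) \<partial>lborel) = 1"
    and \<pi>_cont: "isCont \<pi> \<theta>0"
    and \<pi>_pos: "\<pi> \<theta>0 > 0"
    and f_meas: "\<And>n. f n \<in> borel_measurable lborel"
    and z_fin: "\<And>n. (\<integral>\<^sup>+ \<theta>. ennreal (exp (f n \<theta>) * \<pi> \<theta>) \<partial>lborel) < \<infinity>"
    and \<theta>n_lim: "\<theta>n \<longlonglongrightarrow> \<theta>0"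
    \<comment> \<open>(C1)\<close>
    and H_sym: "\<And>n. transpose (H n) = H n"
    and H0_sym: "transpose H0 = H0"
    and H_lim: "H \<longlonglongrightarrow> H0"
    and H0_pd: "pos_def_mat H0"
    and f_decomp: "\<And>n \<theta>. f n \<theta> = f n (\<theta>n n)
          - real n / 2 * ((\<theta> - \<theta>n n) \<bullet> (H n *v (\<theta> - \<theta>n n))) + r n \<theta>"
    and r_lim: "\<And>x. (\<lambda>n. r n (\<theta>n n + (1 / sqrt (real n)) *\<^sub>R x) - r n (\<theta>n n)) \<longlonglongrightarrow> 0"
    and \<epsilon>0_pos: "\<epsilon>0 > 0"
    and c0_nonneg: "c0 \<ge> 0"
    and c_lim: "c \<longlonglongrightarrow> 0"
    and d_limsup: "limsup (\<lambda>n. ereal (d n)) < \<infinity>"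
    and r_bound: "\<And>n x. norm x < \<epsilon>0 * sqrt (real n) \<Longrightarrow>
          r n (\<theta>n n + (1 / sqrt (real n)) *\<^sub>R x) - r n (\<theta>n n)
            \<le> c0 * norm x ^ 3 / sqrt (real n) + x \<bullet> c n + d n"
    \<comment> \<open>(C2)\<close>
    and C2: "\<And>\<epsilon>. 0 < \<epsilon> \<Longrightarrow> \<epsilon> < \<epsilon>0 \<Longrightarrow>
          liminf (\<lambda>n. INF \<theta>\<in>{\<theta>. norm (\<theta> - \<theta>n n) \<ge> \<epsilon>}.
                     ereal ((f n (\<theta>n n) - f n \<theta>) / real n)) > 0"
  shows "(\<lambda>n. \<integral>\<^sup>+ x. ennreal \<bar>
            real n powr (- real CARD('p) / 2)
              * (exp (f n (\<theta>n n + (1 / sqrt (real n)) *\<^sub>R x)) * \<pi> (\<theta>n n + (1 / sqrt (real n)) *\<^sub>R x)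
                 / enn2real (\<integral>\<^sup>+ \<theta>. ennreal (exp (f n \<theta>) * \<pi> \<theta>) \<partial>lborel))
            - gauss_density (matrix_inv H0) x\<bar> \<partial>lborel)
         \<longlonglongrightarrow> 0"
proof -

  \<comment> \<open>Local coordinates and choice of constants\<close>
  define \<psi> where "\<psi> n x = \<theta>n n + (1 / sqrt (real n)) *\<^sub>R x" for n x
  define e where "e n x = f n (\<psi> n x) - f n (\<theta>n n)" for n x
  have \<pi>_borel [measurable]: "\<pi> \<in> borel_measurable borel"
    and f_borel [measurable]: "f n \<in> borel_measurable borel" for n
    using \<pi>_meas f_meas by simp_all
  have \<psi>_meas [measurable]: "\<psi> n \<in> borel_measurable borel" for n
    unfolding \<psi>_def by measurable

  \<comment> \<open>Evaluating the expansion at its centre shows that the remainder vanishes there.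
    For positive \<open>n\<close> the factor \<open>real n\<close> cancels the square of
    \<open>1 / sqrt (real n)\<close>.\<close>
  have e_eq: "e n x = - (x \<bullet> (H n *v x)) / 2 + (r n (\<psi> n x) - r n (\<theta>n n))" if "n > 0" for n x
  proof -
    have "r n (\<theta>n n) = 0" using f_decomp[of n "\<theta>n n"] by simp
    moreover have "real n / 2 * ((\<psi> n x - \<theta>n n) \<bullet> (H n *v (\<psi> n x - \<theta>n n))) = (x \<bullet> (H n *v x)) / 2"
      using that by (simp add: \<psi>_def matrix_vector_mult_scaleR)
    ultimately show ?thesis using f_decomp[of n "\<psi> n x"] by (simp add: e_def)
  qed

  obtain m where m: "m > 0" and coercive: "\<And>x. x \<bullet> (H0 *v x) \<ge> m * (norm x)\<^sup>2"
    by (rule pos_def_mat_coercive[OF H0_sym H0_pd]) blast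
  \<comment> \<open>The limsup may be minus infinity, so a real number strictly above it is chosen;
    it bounds \<open>d n\<close> eventually.\<close>
  obtain D where D: "limsup (\<lambda>n. ereal (d n)) < ereal D"
    using less_PInf_Ex_of_nat[of "limsup (\<lambda>n. ereal (d n))"] d_limsup by auto
  obtain s where s: "s > 0" and \<pi>_le: "\<And>\<theta>. dist \<theta> \<theta>0 < s \<Longrightarrow> \<pi> \<theta> \<le> 2 * \<pi> \<theta>0"
  proof -
    have "\<exists>s>0. \<forall>\<theta>. dist \<theta> \<theta>0 < s \<longrightarrow> dist (\<pi> \<theta>) (\<pi> \<theta>0) < \<pi> \<theta>0"
      using \<pi>_cont \<pi>_pos unfolding continuous_at_eps_delta by blast
    then obtain s where s: "s > 0" "\<And>\<theta>. dist \<theta> \<theta>0 < s \<Longrightarrow> dist (\<pi> \<theta>) (\<pi> \<theta>0) < \<pi> \<theta>0"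
      by blast
    have "\<pi> \<theta> \<le> 2 * \<pi> \<theta>0" if "dist \<theta> \<theta>0 < s" for \<theta>
      using s(2)[OF that] by (simp add: dist_real_def abs_if split: if_splits)
    then show ?thesis using that s(1) by blast
  qed
  \<comment> \<open>The first entry keeps points within \<epsilon> of \<open>\<theta>n n\<close>
    inside the \<open>s\<close>-ball about \<open>\<theta>0\<close>, the second keeps \<epsilon>
    strictly below \<open>\<epsilon>0\<close>, and the third gives
    \<open>c0 * \<epsilon> \<le> m / 16\<close>. Adding 1 to \<open>c0\<close> covers the case
    \<open>c0 = 0\<close>.\<close>
  define \<epsilon> where "\<epsilon> = min (s / 2) (min (\<epsilon>0 / 2) (m / (16 * (c0 + 1))))"
  have \<epsilon>: "\<epsilon> > 0" "\<epsilon> < \<epsilon>0" "2 * \<epsilon> \<le> s"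
    using s m \<epsilon>0_pos c0_nonneg by (auto simp: \<epsilon>_def)
  have c0\<epsilon>: "c0 * \<epsilon> \<le> m / 16"
  proof -
    have "c0 * \<epsilon> \<le> (c0 + 1) * (m / (16 * (c0 + 1)))"
      using \<epsilon>(1) c0_nonneg by (intro mult_mono) (auto simp: \<epsilon>_def)
    also have "\<dots> = m / 16"
      using c0_nonneg nonzero_mult_divide_mult_cancel_left[of "c0 + 1" m 16] by (simp add: mult.commute)
    finally show ?thesis .
  qed
  \<comment> \<open>The liminf in (C2) may be infinite, so a real rate is chosen strictly between
    zero and it.\<close>
  obtain \<delta> where \<delta>: "\<delta> > 0"
    and \<delta>_less: "ereal \<delta> < liminf (\<lambda>n. INF \<theta>\<in>{\<theta>. norm (\<theta> - \<theta>n n) \<ge> \<epsilon>}. ereal ((f n (\<theta>n n) - f n \<theta>) / real n))"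
    using ereal_dense2[OF C2[OF \<epsilon>(1,2)]] by (auto simp: zero_ereal_def)

  have "eventually (\<lambda>n. n > 0 \<and> dist (\<theta>n n) \<theta>0 < \<epsilon> \<and> dist (H n) H0 < m / 2 \<and> dist (c n) 0 < 1 \<and> ereal (d n) < ereal D
      \<and> ereal \<delta> < (INF \<theta>\<in>{\<theta>. norm (\<theta> - \<theta>n n) \<ge> \<epsilon>}. ereal ((f n (\<theta>n n) - f n \<theta>) / real n))) sequentially"
    using m by (intro eventually_conj eventually_gt_at_top tendstoD[OF \<theta>n_lim \<epsilon>(1)] tendstoD[OF H_lim]
        tendstoD[OF c_lim] Limsup_lessD[OF D] less_LiminfD[OF \<delta>_less]) auto
  then obtain N where N: "\<And>n. n \<ge> N \<Longrightarrow> n > 0" "\<And>n. n \<ge> N \<Longrightarrow> dist (\<theta>n n) \<theta>0 < \<epsilon>"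
    "\<And>n. n \<ge> N \<Longrightarrow> norm (H n - H0) < m / 2" "\<And>n. n \<ge> N \<Longrightarrow> norm (c n) < 1" "\<And>n. n \<ge> N \<Longrightarrow> d n < D"
    and N_inf: "\<And>n. n \<ge> N \<Longrightarrow> ereal \<delta> < (INF \<theta>\<in>{\<theta>. norm (\<theta> - \<theta>n n) \<ge> \<epsilon>}. ereal ((f n (\<theta>n n) - f n \<theta>) / real n))"
    unfolding eventually_sequentially dist_norm by auto

  \<comment> \<open>Bounds on the log-likelihood ratio outside and inside the growing ball\<close>
  have e_tail: "e n x \<le> - \<delta> * real n" if n: "n \<ge> N" and x: "norm x \<ge> \<epsilon> * sqrt (real n)" for n x
  proof -
    have "norm (\<psi> n x - \<theta>n n) \<ge> \<epsilon>"
      using N(1)[OF n] x by (simp add: \<psi>_def field_simps)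
    then have "ereal \<delta> < ereal ((f n (\<theta>n n) - f n (\<psi> n x)) / real n)"
      by (intro less_le_trans[OF N_inf[OF n]] INF_lower) simp
    then show ?thesis using N(1)[OF n] by (simp add: e_def field_simps)
  qed

  \<comment> \<open>Half of the coercivity of \<open>H0\<close> survives for \<open>H n\<close>, so
    the quadratic part of \<open>e n x\<close> is at most -(m/4) |x|^2. The cubic and the linear
    term each use up m/16 of this, which leaves -(m/8) |x|^2.\<close>
  have e_body: "e n x \<le> 4 / m + D - m / 8 * (norm x)\<^sup>2" if n: "n \<ge> N" and x: "norm x < \<epsilon> * sqrt (real n)" for n x
  proof -
    have n0: "real n > 0" using N(1)[OF n] by simp
    have "x \<bullet> ((H n - H0) *v x) \<ge> - (m / 2 * (norm x)\<^sup>2)"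
    proof -
      have "\<bar>x \<bullet> ((H n - H0) *v x)\<bar> \<le> norm x * (norm (H n - H0) * norm x)"
        by (rule order_trans[OF Cauchy_Schwarz_ineq2 mult_left_mono[OF norm_matrix_vector_mult_le]]) simp
      also have "\<dots> \<le> norm x * (m / 2 * norm x)"
        using N(3)[OF n] by (intro mult_left_mono mult_right_mono) auto
      finally show ?thesis by (simp add: power2_eq_square mult_ac)
    qed
    then have quad: "x \<bullet> (H n *v x) \<ge> m / 2 * (norm x)\<^sup>2"
      using coercive[of x] by (simp add: matrix_vector_mult_diff_rdistrib inner_diff_right)
    have "norm x < \<epsilon>0 * sqrt (real n)"
      using x \<epsilon>(2) n0 by (smt (verit) mult_right_mono real_sqrt_ge_zero)
    from r_bound[OF this]
    have rb: "r n (\<psi> n x) - r n (\<theta>n n) \<le> c0 * norm x ^ 3 / sqrt (real n) + x \<bullet> c n + d n"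
      by (simp add: \<psi>_def)
    have cubic: "c0 * norm x ^ 3 / sqrt (real n) \<le> m / 16 * (norm x)\<^sup>2"
    proof -
      have "c0 * norm x ^ 3 / sqrt (real n) = c0 * (norm x / sqrt (real n)) * (norm x)\<^sup>2"
        by (simp add: power2_eq_square power3_eq_cube)
      also have "\<dots> \<le> c0 * \<epsilon> * (norm x)\<^sup>2"
        using x n0 c0_nonneg by (intro mult_right_mono mult_left_mono) (auto simp: field_simps)
      also have "\<dots> \<le> m / 16 * (norm x)\<^sup>2"
        using c0\<epsilon> by (intro mult_right_mono) auto
      finally show ?thesis .
    qed
    have "x \<bullet> c n \<le> norm x * norm (c n)" by (rule norm_cauchy_schwarz)
    also have "\<dots> \<le> norm x" using N(4)[OF n] by (simp add: mult_left_le)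
    \<comment> \<open>Completing the square with leading coefficient m/16 leaves the constant
      4/m.\<close>
    also have "norm x \<le> m / 16 * (norm x)\<^sup>2 + 4 / m"
    proof -
      have "0 \<le> (m * norm x - 8)\<^sup>2 / (16 * m)" using m by simp
      also have "\<dots> = m / 16 * (norm x)\<^sup>2 + 4 / m - norm x"
        using m by (simp add: power2_eq_square field_simps)
      finally show ?thesis by simp
    qed
    finally have lin: "x \<bullet> c n \<le> m / 16 * (norm x)\<^sup>2 + 4 / m" .
    show ?thesis
      using e_eq[OF N(1)[OF n], of x] N(5)[OF n] rb quad cubic lin by linarith
  qed

  \<comment> \<open>The cutoff makes the bounds valid for every index; it also excludes \<open>n = 0\<close>, where
    \<open>1 / sqrt 0 = 0\<close> makes \<open>\<psi> 0\<close> constant.\<close>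
  define g where "g n x = of_bool (N \<le> n) * (exp (e n x) * \<pi> (\<psi> n x))" for n x
  define g0 where "g0 x = exp (- (x \<bullet> (H0 *v x)) / 2) * \<pi> \<theta>0" for x
  define S where "S n = {x :: real^'p. norm x < \<epsilon> * sqrt (real n)}" for n
  \<comment> \<open>The factor \<open>2 * \<pi> \<theta>0\<close> bounds the prior near
    \<open>\<theta>0\<close>; the exponentials are the bound of \<open>e_body\<close>.\<close>
  define w where "w x = 2 * \<pi> \<theta>0 * exp (4 / m + D) * exp (- (m / 8 * (norm x)\<^sup>2))" for x :: "real^'p"
  have [measurable]: "e n \<in> borel_measurable borel" for n
    unfolding e_def by measurable
  have g_meas: "g n \<in> borel_measurable lborel" for n
    unfolding g_def by measurable
  have S_meas: "S n \<in> sets lborel" for n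
    unfolding S_def by measurable
  have g_nonneg: "g n x \<ge> 0" and g0_nonneg: "g0 x \<ge> 0" for n x
    by (simp_all add: g_def g0_def \<pi>_nonneg)
  have w_int: "integrable lborel w"
    unfolding w_def using m by (intro integrable_mult_right integrable_exp_neg_norm_square) simp

  \<comment> \<open>Pointwise limit and Gaussian domination\<close>
  have g_lim: "(\<lambda>n. g n x) \<longlonglongrightarrow> g0 x" for x
  proof -
    have "(\<lambda>n. 1 / sqrt (real n)) \<longlonglongrightarrow> 0" by real_asymp
    then have "(\<lambda>n. \<psi> n x) \<longlonglongrightarrow> \<theta>0 + 0 *\<^sub>R x"
      unfolding \<psi>_def by (intro tendsto_intros \<theta>n_lim)
    then have pi_lim: "(\<lambda>n. \<pi> (\<psi> n x)) \<longlonglongrightarrow> \<pi> \<theta>0"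
      using isCont_tendsto_compose[OF \<pi>_cont] by simp
    have "(\<lambda>n. H n *v x) \<longlonglongrightarrow> H0 *v x"
      unfolding matrix_vector_mult_def by (intro tendsto_intros H_lim)
    then have "(\<lambda>n. exp (- (x \<bullet> (H n *v x)) / 2 + (r n (\<psi> n x) - r n (\<theta>n n))) * \<pi> (\<psi> n x))
        \<longlonglongrightarrow> exp (- (x \<bullet> (H0 *v x)) / 2 + 0) * \<pi> \<theta>0"
      unfolding \<psi>_def by (intro tendsto_intros r_lim pi_lim[unfolded \<psi>_def]) auto
    moreover have "eventually (\<lambda>n. exp (- (x \<bullet> (H n *v x)) / 2 + (r n (\<psi> n x) - r n (\<theta>n n))) * \<pi> (\<psi> n x) = g n x) sequentially"
      using eventually_ge_at_top[of N] by eventually_elim (simp add: g_def e_eq N(1))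
    ultimately show ?thesis by (simp add: g0_def tendsto_cong)
  qed

  have exhaust: "eventually (\<lambda>n. x \<in> S n) sequentially" for x
  proof -
    have "filterlim (\<lambda>n. \<epsilon> * sqrt (real n)) at_top sequentially"
      using \<epsilon>(1) by real_asymp
    then show ?thesis unfolding S_def filterlim_at_top_dense by simp
  qed

  have dom: "g n x \<le> w x" if "x \<in> S n" for n x
  proof (cases "n \<ge> N")
    case True
    have x: "norm x < \<epsilon> * sqrt (real n)" using that by (simp add: S_def)
    have "dist (\<psi> n x) (\<theta>n n) < \<epsilon>"
      using x N(1)[OF True] by (simp add: \<psi>_def dist_norm field_simps)
    then have "dist (\<psi> n x) \<theta>0 < s"
      using N(2)[OF True] \<epsilon>(3) dist_triangle[of "\<psi> n x" \<theta>0 "\<theta>n n"] by linarith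
    then have "\<pi> (\<psi> n x) \<le> 2 * \<pi> \<theta>0" by (rule \<pi>_le)
    then have "exp (e n x) * \<pi> (\<psi> n x) \<le> exp (4 / m + D - m / 8 * (norm x)\<^sup>2) * (2 * \<pi> \<theta>0)"
      using e_body[OF True x] by (intro mult_mono) (auto simp: \<pi>_nonneg)
    also have "\<dots> = w x" unfolding w_def diff_conv_add_uminus exp_add by (simp only: mult_ac)
    finally show ?thesis using True by (simp add: g_def)
  qed (simp add: g_def w_def \<pi>_nonneg)

  \<comment> \<open>Normalising constants and tail mass\<close>
  have scaled: "integrable lborel (g n)"
    "enn2real (\<integral>\<^sup>+ \<theta>. ennreal (exp (f n \<theta>) * \<pi> \<theta>) \<partial>lborel)
      = (1 / sqrt (real n)) ^ CARD('p) * (exp (f n (\<theta>n n)) * (\<integral>x. g n x \<partial>lborel))" if n: "n \<ge> N" for n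
  proof -
    have c: "1 / sqrt (real n) > 0" using N(1)[OF n] by simp
    have g_eq: "g n = (\<lambda>x. exp (- f n (\<theta>n n)) * (exp (f n (\<psi> n x)) * \<pi> (\<psi> n x)))"
      using n by (simp add: fun_eq_iff g_def e_def exp_diff exp_minus divide_inverse)
    have meas: "(\<lambda>\<theta>. exp (f n \<theta>) * \<pi> \<theta>) \<in> borel_measurable borel" by measurable
    have nn: "exp (f n \<theta>) * \<pi> \<theta> \<ge> 0" for \<theta> by (simp add: \<pi>_nonneg)
    note aff = integral_lborel_affine_nonneg[OF meas nn z_fin c, of "\<theta>n n", folded \<psi>_def]
    show "integrable lborel (g n)"
      unfolding g_eq by (intro integrable_mult_right aff(1))
    show "enn2real (\<integral>\<^sup>+ \<theta>. ennreal (exp (f n \<theta>) * \<pi> \<theta>) \<partial>lborel)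
      = (1 / sqrt (real n)) ^ CARD('p) * (exp (f n (\<theta>n n)) * (\<integral>x. g n x \<partial>lborel))"
      unfolding g_eq aff(2) by (simp add: exp_minus)
  qed
  have g_int: "integrable lborel (g n)" for n
  proof (cases "n \<ge> N")
    case False
    then have "g n = (\<lambda>x. 0)" by (simp add: g_def fun_eq_iff)
    then show ?thesis by simp
  qed (rule scaled(1))

  have tail: "(\<lambda>n. \<integral>x. g n x * indicator (- S n) x \<partial>lborel) \<longlonglongrightarrow> 0"
  proof (rule tendsto_sandwich[OF _ _ tendsto_const exp_neg_mult_sqrt_power_tendsto_0[OF \<delta>, of "CARD('p)"]])
    show "eventually (\<lambda>n. 0 \<le> (\<integral>x. g n x * indicator (- S n) x \<partial>lborel)) sequentially"
      by (intro always_eventually allI integral_nonneg_AE AE_I2) (simp add: g_nonneg)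
    show "eventually (\<lambda>n. (\<integral>x. g n x * indicator (- S n) x \<partial>lborel) \<le> exp (- \<delta> * real n) * sqrt (real n) ^ CARD('p)) sequentially"
      using eventually_ge_at_top[of N]
    proof eventually_elim
      case (elim n)
      have n0: "real n > 0" using N(1)[OF elim] by simp
      then have c: "1 / sqrt (real n) > 0" by simp
      have "(\<integral>\<^sup>+ \<theta>. ennreal (\<pi> \<theta>) \<partial>lborel) < \<infinity>" by (simp add: \<pi>_int)
      note aff = integral_lborel_affine_nonneg[OF \<pi>_borel \<pi>_nonneg this c, of "\<theta>n n", folded \<psi>_def]
      \<comment> \<open>The prior has mass one, so in local coordinates its integral is the inverse
        Jacobian. Outside the ball \<open>g n\<close> is at most
        \<open>exp (- \<delta> * real n)\<close> times this prior, and the exponential beats the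
        power of \<open>n\<close>.\<close>
      have "(\<integral>x. \<pi> (\<psi> n x) \<partial>lborel) = sqrt (real n) ^ CARD('p)"
        using aff(2) n0 by (simp add: \<pi>_int power_divide field_simps)
      moreover have "(\<integral>x. g n x * indicator (- S n) x \<partial>lborel) \<le> (\<integral>x. exp (- \<delta> * real n) * \<pi> (\<psi> n x) \<partial>lborel)"
      proof (rule integral_mono)
        show "integrable lborel (\<lambda>x. g n x * indicator (- S n) x)"
          using S_meas[of n] by (intro integrable_real_mult_indicator g_int) simp
        show "integrable lborel (\<lambda>x. exp (- \<delta> * real n) * \<pi> (\<psi> n x))"
          by (intro integrable_mult_right aff(1))
        show "g n x * indicator (- S n) x \<le> exp (- \<delta> * real n) * \<pi> (\<psi> n x)" for x
        proof (cases "x \<in> S n")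
          case False
          then have "exp (e n x) \<le> exp (- \<delta> * real n)"
            using e_tail[OF elim, of x] by (simp add: S_def not_less)
          then show ?thesis
            using False by (simp add: g_def elim \<pi>_nonneg mult_right_mono)
        qed (simp add: \<pi>_nonneg)
      qed
      ultimately show ?case by simp
    qed
  qed

  \<comment> \<open>Identification of the limit and conclusion\<close>
  note trunc = tendsto_integral_truncate[OF g_meas S_meas g_nonneg w_int g_lim exhaust dom g_int tail]

  let ?K = "(2 * pi) powr (real CARD('p) / 2) * det H0 powr (-1/2)"
  have K_pos: "?K > 0" using pos_def_mat_det_pos[OF H0_sym H0_pd] by simp
  have g0_integral: "(\<integral>x. g0 x \<partial>lborel) = ?K * \<pi> \<theta>0"
  proof -
    have "(\<integral>x. exp (- (x \<bullet> (H0 *v x)) / 2) \<partial>lborel) = ?K"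
      using K_pos by (subst integral_eq_nn_integral)
        (simp_all only: nn_integral_exp_neg_quadratic_form[OF H0_sym H0_pd], auto)
    then show ?thesis by (simp add: g0_def)
  qed
  have gauss: "gauss_density (matrix_inv H0) x = g0 x / (\<integral>x. g0 x \<partial>lborel)" for x
    unfolding gauss_density_matrix_inv[OF H0_sym H0_pd] g0_integral
    unfolding g0_def using \<pi>_pos by simp

  have conv: "(\<lambda>n. \<integral>\<^sup>+x. ennreal \<bar>g n x / (\<integral>x. g n x \<partial>lborel) - g0 x / (\<integral>x. g0 x \<partial>lborel)\<bar> \<partial>lborel) \<longlonglongrightarrow> 0"
    by (rule normalised_L1_convergence[OF g_int trunc(1) g_nonneg g0_nonneg g_lim trunc(2)])
      (use K_pos \<pi>_pos in \<open>auto simp: g0_integral\<close>)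

  \<comment> \<open>The Jacobian and the factor \<open>exp (f n (\<theta>n n))\<close> in the
    normalising constant cancel, so from \<open>N\<close> on the rescaled posterior density is
    \<open>g n\<close> divided by its integral.\<close>
  have density: "real n powr (- real CARD('p) / 2) * (exp (f n (\<psi> n x)) * \<pi> (\<psi> n x)
      / enn2real (\<integral>\<^sup>+ \<theta>. ennreal (exp (f n \<theta>) * \<pi> \<theta>) \<partial>lborel)) = g n x / (\<integral>x. g n x \<partial>lborel)"
    if n: "n \<ge> N" for n x
  proof -
    have n0: "real n > 0" using N(1)[OF n] by simp
    have "(1 / sqrt (real n)) ^ CARD('p) = real n powr (- real CARD('p) / 2)"
      using n0 by (simp add: powr_half_sqrt[symmetric] powr_powr powr_minus_divide power_divide flip: powr_realpow)
    moreover have "g n x = exp (f n (\<psi> n x)) * \<pi> (\<psi> n x) / exp (f n (\<theta>n n))"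
      using n by (simp add: g_def e_def exp_diff)
    ultimately show ?thesis
      unfolding scaled(2)[OF n] using n0 by simp
  qed
  show ?thesis
    unfolding gauss \<psi>_def[symmetric]
    by (rule Lim_transform_eventually[OF conv])
      (use eventually_ge_at_top[of N] in eventually_elim, simp only: density)
qed

end
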